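(* Consider the Non-Linear Knapsack-Cover problem (defined in the context) in the list model. Algorithm 1 (the primal-dual water-filling algorithm described in the context) is a 2-approximation: its output $\bar z$ satisfies $\bar z_{ij}=1\Rightarrow \bar z_{i,j-1}=1$ for all $i\in N$, $2\le j\le m$, the vector $x$ with $x_i=\max(\{0\}\cup\{j:\bar z_{ij}=1\})$ satisfies $\sum_{i\in N}x_i\ge D$, and its cost is at most twice the minimum cost of a feasible solution.
   Context: Non-Linear Knapsack-Cover problem: given a finite set $N$ of $n$ items, a demand $D\in\mathbb{N}$, an integer $m\le D$, and for each $i\in N$ a non-decreasing function $f_i:\{0,1,\dots,m\}\to\mathbb{Q}_{\ge0}\cup\{\infty\}$, choose $x\in\{0,\dots,m\}^N$ with $\sum_{i\in N}x_i\ge D$ minimizing $\sum_{i\in N} f_i(x_i)$. The instance is assumed to admit a feasible solution. In the list model the values $f_i(0),\dots,f_i(m)$ are given explicitly. Let $M=\{1,\dots,m\}$ and $g_{ij}=f_i(j)-f_i(j-1)\ge 0$ for $i\in N,j\in M$. A choice $x$ is encoded by $z\in\{0,1\}^{N\times M}$ with $z_{ij}=1$ iff $x_i\ge j$. For $a\in\{0,\dots,m\}^N$ let $D(a)=\max\{D-\sum_{i\in N}a_i,0\}$ and $m_i(a)=\min\{m,a_i+D(a)\}$. Let $\mathcal F$ be the set of pairs $(a,F)$ where $a\in\{0,\dots,m\}^N$ and $F=(F_i^k)_{i\in N,k\in\{0,\dots,m-1\}}$ are sets such that, for each $i$, $F_i^0,\dots,F_i^{m-1}$ are pairwise disjoint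 with union $\{a_i+1,\dots,m\}$, and $j\in F_i^k$ implies $j-k\ge1$. Define $\tau(i,j,a,F)=|\{\ell\in\mathbb{N}:\ell\ge j,\ \ell\in F_i^{\ell-j},\ \ell\le m_i(a)\}|$. The dual LP [D-GKC] is: maximize $\sum_{(a,F)\in\mathcal F}D(a)v_{aF}$ subject to $\sum_{(a,F)\in\mathcal F:\,a_i<j}\tau(i,j,a,F)\,v_{aF}\le g_{ij}$ for all $i\in N,j\in M$, and $v\ge0$. (It is the dual of [P-GKC]: minimize $\sum_{i,j}g_{ij}z_{ij}$ s.t. $\sum_{i\in N}\sum_{j=a_i+1}^m\tau(i,j,a,F)z_{ij}\ge D(a)$ for all $(a,F)\in\mathcal F$, $z\ge0$.) Algorithm 1: call the pair $(i,j)$ (a "bucket") full when the dual constraint indexed by $(i,j)$ is tight for the current $v$. Initialize $v=0$, $z=0$, $a=0$, $F_i^0=M$ and $F_i^k=\emptyset$ for $k\ge1$. While $D(a)>0$: continuously increase the single variable $v_{aF}$ for the current $(a,F)$ (each $F_i^k$ taken intersected with $\{a_i+1,\dots,m\}$) until some dual constraint indexed by $(i,j)$ becomes tight (pick one if several). If $j=a_i+1$: let $q>a_i$ be maximal such that buckets $(i,a_i+1),\dots,(i,q)$ are all full, set $z_{i\ell}=1$ for $\ell=j,\dots,q$, and set $a_i\leftarrow q$. Otherwise ($j>a_i+1$): let $p<j$ be maximal such that $(i,p)$ is not full, let $q>j$ be minimal such that $(i,q)$ is not full ($q=m+1$ if $(i,j),\dots,(i,m)$ are all full), and for $\ell=j,\dots,q-1$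 remove $\ell$ from $F_i^{\ell-j}$ and add it to $F_i^{\ell-p}$. When $D(a)=0$, output $v,z$.
   Formalization: When several constraints become tight at once, only those ℓ lying in F_i^{ℓ-j} are moved to F_i^{ℓ-p}, and a bucket j>a_i+1 may be picked only if a non-full p<j exists (the literal step is undefined otherwise); that the algorithm can always continue is claimed only if the minimum cost is finite. *)

theory Defs
  imports "HOL-Library.Extended_Real" "HOL-Library.Disjoint_Sets"
begin

section \<open>Non-Linear Knapsack-Cover\<close>

definition feasible :: "'i set \<Rightarrow> nat \<Rightarrow> nat \<Rightarrow> ('i \<Rightarrow> nat) set" where
  "feasible N D m = {x. (\<forall>i\<in>N. x i \<le> m) \<and> (\<Sum>i\<in>N. x i) \<ge> D}"

definition cost :: "'i set \<Rightarrow> ('i \<Rightarrow> nat \<Rightarrow> ereal) \<Rightarrow> ('i \<Rightarrow> nat) \<Rightarrow> ereal" where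
  "cost N f x = (\<Sum>i\<in>N. f i (x i))"

text \<open>For finite \<open>N\<close> the costs of feasible solutions form a finite set, so the infimum
  is a minimum as soon as a feasible solution exists.\<close>
definition opt :: "'i set \<Rightarrow> nat \<Rightarrow> nat \<Rightarrow> ('i \<Rightarrow> nat \<Rightarrow> ereal) \<Rightarrow> ereal" where
  "opt N D m f = (INF x\<in>feasible N D m. cost N f x)"

text \<open>In \<^typ>\<open>ereal\<close> we have \<open>\<infinity> - \<infinity> = \<infinity>\<close>, so the increment is infinite at every level
  of infinite cost.\<close>
definition incr :: "('i \<Rightarrow> nat \<Rightarrow> ereal) \<Rightarrow> 'i \<Rightarrow> nat \<Rightarrow> ereal" where
  "incr f i j = f i j - f i (j - 1)"

section \<open>The dual linear program\<close>

text \<open>Truncated subtraction on \<^typ>\<open>nat\<close> supplies the maximum with 0.\<close>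
definition residual :: "'i set \<Rightarrow> nat \<Rightarrow> ('i \<Rightarrow> nat) \<Rightarrow> nat" where
  "residual N D a = D - (\<Sum>i\<in>N. a i)"

definition cap :: "'i set \<Rightarrow> nat \<Rightarrow> nat \<Rightarrow> ('i \<Rightarrow> nat) \<Rightarrow> 'i \<Rightarrow> nat" where
  "cap N D m a i = min m (a i + residual N D a)"

type_synonym 'i index = "('i \<Rightarrow> nat) \<times> ('i \<Rightarrow> nat \<Rightarrow> nat set)"

text \<open>\<open>F i k\<close> stands for \<open>F\<^sub>i\<^sup>k\<close>. Outside the index ranges \<open>i \<in> N\<close>, \<open>k < m\<close>, the functions are
  fixed to 0 and the empty set, so that each family has exactly one representative and
  the set of indices is finite.\<close>
definition indices :: "'i set \<Rightarrow> nat \<Rightarrow> 'i index set" where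
  "indices N m = {(a, F).
     (\<forall>i\<in>N. a i \<le> m) \<and> (\<forall>i. i \<notin> N \<longrightarrow> a i = 0) \<and>
     (\<forall>i k. i \<notin> N \<or> m \<le> k \<longrightarrow> F i k = {}) \<and>
     (\<forall>i\<in>N. disjoint_family_on (F i) {..<m} \<and>
             (\<Union>k<m. F i k) = {a i + 1..m} \<and>
             (\<forall>k<m. \<forall>j\<in>F i k. k + 1 \<le> j))}"

definition tau :: "'i set \<Rightarrow> nat \<Rightarrow> nat \<Rightarrow> 'i \<Rightarrow> nat \<Rightarrow> 'i index \<Rightarrow> nat" where
  "tau N D m i j = (\<lambda>(a, F). card {l. j \<le> l \<and> l \<in> F i (l - j) \<and> l \<le> cap N D m a i})"

definition dual_lhs ::
  "'i set \<Rightarrow> nat \<Rightarrow> nat \<Rightarrow> ('i index \<Rightarrow> real) \<Rightarrow> 'i \<Rightarrow> nat \<Rightarrow> real" where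
  "dual_lhs N D m v i j =
     (\<Sum>aF\<in>{aF \<in> indices N m. fst aF i < j}. real (tau N D m i j aF) * v aF)"

definition dual_feasible ::
  "'i set \<Rightarrow> nat \<Rightarrow> nat \<Rightarrow> ('i \<Rightarrow> nat \<Rightarrow> ereal) \<Rightarrow> ('i index \<Rightarrow> real) \<Rightarrow> bool" where
  "dual_feasible N D m f v \<longleftrightarrow>
     (\<forall>aF\<in>indices N m. 0 \<le> v aF) \<and>
     (\<forall>i\<in>N. \<forall>j\<in>{1..m}. ereal (dual_lhs N D m v i j) \<le> incr f i j)"

definition full ::
  "'i set \<Rightarrow> nat \<Rightarrow> nat \<Rightarrow> ('i \<Rightarrow> nat \<Rightarrow> ereal) \<Rightarrow> ('i index \<Rightarrow> real) \<Rightarrow> 'i \<Rightarrow> nat \<Rightarrow> bool" where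
  "full N D m f v i j \<longleftrightarrow> ereal (dual_lhs N D m v i j) = incr f i j"

lemma finite_indices:
  assumes "finite N"
  shows "finite (indices N m)"
proof -
  let ?A = "{a::'a \<Rightarrow> nat. \<forall>i. (i \<in> N \<longrightarrow> a i \<in> {..m}) \<and> (i \<notin> N \<longrightarrow> a i = 0)}"
  let ?H = "{h::nat \<Rightarrow> nat set. \<forall>k. (k \<in> {..<m} \<longrightarrow> h k \<in> Pow {..m}) \<and> (k \<notin> {..<m} \<longrightarrow> h k = {})}"
  let ?B = "{F::'a \<Rightarrow> nat \<Rightarrow> nat set. \<forall>i. (i \<in> N \<longrightarrow> F i \<in> ?H) \<and> (i \<notin> N \<longrightarrow> F i = (\<lambda>_. {}))}"
  have "finite ?A"
    by (rule finite_set_of_finite_funs) (use assms in auto)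
  moreover have "finite ?H"
    by (rule finite_set_of_finite_funs) auto
  then have "finite ?B"
    using assms by (rule finite_set_of_finite_funs[rotated])
  moreover have "indices N m \<subseteq> ?A \<times> ?B"
  proof
    fix aF assume "aF \<in> indices N m"
    then obtain a F where aF: "aF = (a, F)" "(a, F) \<in> indices N m"
      by (cases aF) auto
    have "F i k \<subseteq> {..m}" if "i \<in> N" "k < m" for i k
    proof -
      have "F i k \<subseteq> (\<Union>k<m. F i k)" using that by auto
      also have "\<dots> = {a i + 1..m}" using aF that by (simp add: indices_def)
      finally show ?thesis by auto
    qed
    then show "aF \<in> ?A \<times> ?B"
      using aF by (simp add: indices_def fun_eq_iff)
  qed
  ultimately show ?thesis
    by (meson finite_SigmaI finite_subset)
qed

section \<open>The primal-dual algorithm\<close>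

text \<open>A state consists of the current \<open>(v, z, a, F)\<close>.\<close>
type_synonym 'i state =
  "('i index \<Rightarrow> real) \<times> ('i \<Rightarrow> nat \<Rightarrow> nat) \<times> ('i \<Rightarrow> nat) \<times> ('i \<Rightarrow> nat \<Rightarrow> nat set)"

definition init :: "'i set \<Rightarrow> nat \<Rightarrow> 'i state" where
  "init N m = (\<lambda>_. 0, \<lambda>_ _. 0, \<lambda>_. 0, \<lambda>i k. if i \<in> N \<and> k = 0 then {1..m} else {})"

definition current :: "nat \<Rightarrow> ('i \<Rightarrow> nat) \<Rightarrow> ('i \<Rightarrow> nat \<Rightarrow> nat set) \<Rightarrow> 'i index" where
  "current m a F = (a, \<lambda>i k. F i k \<inter> {a i + 1..m})"

text \<open>Raising the current dual variable from \<open>v\<close> until the constraint \<open>(i, j)\<close> becomes tight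
  gives \<open>v'\<close>: the constraint contains the raised variable with a positive coefficient, so the
  amount \<open>e\<close> is the largest one that keeps \<open>v'\<close> dual feasible. The amount is 0 if such a
  constraint is tight already, because its increment is 0 or because it became tight together
  with a bucket chosen earlier.\<close>
definition raise_until_tight ::
  "'i set \<Rightarrow> nat \<Rightarrow> nat \<Rightarrow> ('i \<Rightarrow> nat \<Rightarrow> ereal) \<Rightarrow> ('i index \<Rightarrow> real) \<Rightarrow>
   ('i \<Rightarrow> nat) \<Rightarrow> ('i \<Rightarrow> nat \<Rightarrow> nat set) \<Rightarrow> ('i index \<Rightarrow> real) \<Rightarrow> 'i \<Rightarrow> nat \<Rightarrow> bool" where
  "raise_until_tight N D m f v a F v' i j \<longleftrightarrow>
     (\<exists>e\<ge>0. v' = v(current m a F := v (current m a F) + e)) \<and>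
     dual_feasible N D m f v' \<and>
     i \<in> N \<and> j \<in> {1..m} \<and> a i < j \<and> tau N D m i j (current m a F) > 0 \<and>
     full N D m f v' i j"

text \<open>Moves every \<open>l\<close> with \<open>j \<le> l < q\<close> from \<open>F\<^sub>i\<^bsup>l-j\<^esup>\<close> to \<open>F\<^sub>i\<^bsup>l-p\<^esup>\<close>. A level \<open>l\<close> that does not lie
  in \<open>F\<^sub>i\<^bsup>l-j\<^esup>\<close> stays where it is; this happens only if another bucket of \<open>i\<close> became full
  simultaneously with \<open>(i, j)\<close>.\<close>
definition shift ::
  "('i \<Rightarrow> nat \<Rightarrow> nat set) \<Rightarrow> 'i \<Rightarrow> nat \<Rightarrow> nat \<Rightarrow> nat \<Rightarrow> 'i \<Rightarrow> nat \<Rightarrow> nat set" where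
  "shift F i j p q = F(i := \<lambda>k.
     (F i k - {l \<in> {j..<q}. k = l - j}) \<union> {l \<in> {j..<q}. l \<in> F i (l - j) \<and> k = l - p})"

text \<open>One iteration of the loop; ties are resolved nondeterministically. In \<open>redirect\<close> a
  non-full \<open>p < j\<close> has to exist. It can fail to exist only if the bucket \<open>(i, a i + 1)\<close> is full
  together with \<open>(i, j)\<close>, in which case that bucket can be chosen instead.\<close>
inductive step ::
  "'i set \<Rightarrow> nat \<Rightarrow> nat \<Rightarrow> ('i \<Rightarrow> nat \<Rightarrow> ereal) \<Rightarrow> 'i state \<Rightarrow> 'i state \<Rightarrow> bool"
  for N D m f where
  advance:
    "\<lbrakk>residual N D a > 0;
      raise_until_tight N D m f v a F v' i j;
      j = a i + 1;
      q = Max {q. a i < q \<and> q \<le> m \<and> (\<forall>l\<in>{a i + 1..q}. full N D m f v' i l)}\<rbrakk>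
     \<Longrightarrow> step N D m f (v, z, a, F)
           (v', z(i := \<lambda>l. if l \<in> {j..q} then 1 else z i l), a(i := q), F)"
| redirect:
    "\<lbrakk>residual N D a > 0;
      raise_until_tight N D m f v a F v' i j;
      j > a i + 1;
      {p \<in> {1..<j}. \<not> full N D m f v' i p} \<noteq> {};
      p = Max {p \<in> {1..<j}. \<not> full N D m f v' i p};
      q = Min ({q \<in> {j<..m}. \<not> full N D m f v' i q} \<union> {m + 1})\<rbrakk>
     \<Longrightarrow> step N D m f (v, z, a, F) (v', z, a, shift F i j p q)"

definition reachable ::
  "'i set \<Rightarrow> nat \<Rightarrow> nat \<Rightarrow> ('i \<Rightarrow> nat \<Rightarrow> ereal) \<Rightarrow> 'i state \<Rightarrow> bool" where
  "reachable N D m f s \<longleftrightarrow> (step N D m f)\<^sup>*\<^sup>* (init N m) s"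

definition is_output ::
  "'i set \<Rightarrow> nat \<Rightarrow> nat \<Rightarrow> ('i \<Rightarrow> nat \<Rightarrow> ereal) \<Rightarrow> ('i index \<Rightarrow> real) \<Rightarrow> ('i \<Rightarrow> nat \<Rightarrow> nat) \<Rightarrow> bool"
  where
  "is_output N D m f v z \<longleftrightarrow> (\<exists>a F. reachable N D m f (v, z, a, F) \<and> residual N D a = 0)"

definition decode :: "nat \<Rightarrow> ('i \<Rightarrow> nat \<Rightarrow> nat) \<Rightarrow> 'i \<Rightarrow> nat" where
  "decode m z i = Max ({0} \<union> {j \<in> {1..m}. z i j = 1})"

end

theory Submission
  imports Defs
begin

text \<open>Read \<open>l \<in> F\<^sub>i\<^bsup>l-t\<^esup>\<close> as: level \<open>l\<close> of item \<open>i\<close> pours its water into bucket \<open>t \<le> l\<close>. Throughout the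
  algorithm all buckets in \<open>(t, l]\<close> and all buckets up to \<open>a\<^sub>i\<close> are full, and \<open>t > a\<^sub>i\<close> whenever
  \<open>l > a\<^sub>i\<close>. Since an item is always advanced to just below a non-full bucket, no level beyond the
  final \<open>x\<^sub>i\<close> ever poured into a bucket \<open>\<le> x\<^sub>i\<close>. Hence a dual variable \<open>v\<^sub>a\<^sub>F\<close> pays at most
  \<open>\<Sum>\<^sub>i (min x\<^sub>i (m\<^sub>i(a)) - a\<^sub>i)\<close> times for the bought buckets, and this is at most \<open>2 D(a)\<close>: before the
  last advance the purchases beyond \<open>a\<close> number less than \<open>D(a)\<close>, and the last item adds at most
  \<open>D(a)\<close> because of the cap. Conversely, any feasible solution collects every raised variable at
  least \<open>D(a)\<close> times, since water only flows downwards.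

  A chosen bucket is never chosen again: it is either bought, or no level pours into it any more.
  The algorithm does not get stuck while a finite-cost solution exists, because that solution
  exceeds \<open>a\<close> at some item \<open>i\<close>, and bucket \<open>(i, a\<^sub>i + 1)\<close> receives water and has finite capacity.\<close>

text \<open>The sets \<open>F\<close> in which level \<open>l\<close> of item \<open>i\<close> pours into bucket \<open>t i l\<close>.\<close>
definition route_sets :: "'i set \<Rightarrow> nat \<Rightarrow> ('i \<Rightarrow> nat \<Rightarrow> nat) \<Rightarrow> 'i \<Rightarrow> nat \<Rightarrow> nat set" where
  "route_sets N m t i k = (if i \<in> N then {l \<in> {1..m}. k = l - t i l} else {})"

lemma mem_route_sets:
  "l \<in> route_sets N m t i k \<longleftrightarrow> i \<in> N \<and> 1 \<le> l \<and> l \<le> m \<and> k = l - t i l"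
  by (auto simp: route_sets_def)

text \<open>The buckets that can still be chosen.\<close>
definition remaining :: "'i set \<Rightarrow> nat \<Rightarrow> 'i state \<Rightarrow> ('i \<times> nat) set" where
  "remaining N m = (\<lambda>(v, z, a, F). {(i, j). i \<in> N \<and> j \<in> {1..m} \<and> a i < j \<and>
     (\<exists>l\<in>{j..m}. l \<in> F i (l - j))})"

section \<open>Water routings and the loop invariant\<close>

locale knapsack_cover =
  fixes N :: "'i set" and D m :: nat and f :: "'i \<Rightarrow> nat \<Rightarrow> ereal"
  assumes finite_N: "finite N"
    and cost_nonneg: "\<And>i j. i \<in> N \<Longrightarrow> j \<le> m \<Longrightarrow> 0 \<le> f i j"
    and cost_mono: "\<And>i. i \<in> N \<Longrightarrow> mono_on {0..m} (f i)"
begin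

text \<open>Levels up to \<open>a i\<close> keep a route too: buying buckets leaves \<open>F\<close>
  untouched, and only \<open>current\<close> discards those levels. Fullness is measured at the
  given \<open>v\<close>, so a routing computed earlier can be tested against a later dual
  solution.\<close>

definition routing :: "('i index \<Rightarrow> real) \<Rightarrow> ('i \<Rightarrow> nat) \<Rightarrow> ('i \<Rightarrow> nat \<Rightarrow> nat) \<Rightarrow> bool" where
  "routing v a t \<longleftrightarrow> (\<forall>i. i \<notin> N \<longrightarrow> a i = 0) \<and>
     (\<forall>i\<in>N. a i \<le> m \<and> (\<forall>l\<in>{1..m}. 1 \<le> t i l \<and> t i l \<le> l \<and> (a i < l \<longrightarrow> a i < t i l) \<and>
        (\<forall>b\<in>{t i l<..l}. full N D m f v i b)))"

text \<open>A dual variable with index \<open>current m b (route_sets N m u)\<close> was raised on the way to \<open>(v, a)\<close>.\<close>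
definition supported ::
  "('i index \<Rightarrow> real) \<Rightarrow> ('i \<Rightarrow> nat) \<Rightarrow> ('i \<Rightarrow> nat) \<Rightarrow> ('i \<Rightarrow> nat \<Rightarrow> nat) \<Rightarrow> bool" where
  "supported v a b u \<longleftrightarrow> routing v b u \<and> (\<forall>i. b i \<le> a i) \<and>
     (\<forall>i\<in>N. \<forall>l\<in>{b i<..m}. u i l \<le> a i \<longrightarrow> l \<le> a i)"

text \<open>The last conjunct carries the approximation ratio: every nonzero variable stems from a
  past routing, and the levels above \<open>b\<close> that are bought and within the cap number at
  most twice the residual demand at \<open>b\<close>.\<close>

definition step_inv :: "'i state \<Rightarrow> bool" where
  "step_inv = (\<lambda>(v, z, a, F).
     (\<exists>t. F = route_sets N m t \<and> routing v a t) \<and>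
     dual_feasible N D m f v \<and>
     (\<forall>i\<in>N. \<forall>j\<in>{1..a i}. full N D m f v i j) \<and>
     z = (\<lambda>i l. if l \<in> {1..a i} then 1 else 0) \<and>
     (\<forall>aF\<in>indices N m. v aF \<noteq> 0 \<longrightarrow>
        (\<exists>b u. aF = current m b (route_sets N m u) \<and> supported v a b u \<and>
          (\<Sum>i\<in>N. min (a i) (cap N D m b i) - b i) \<le> 2 * residual N D b)))"

section \<open>Cost increments and permanence of full buckets\<close>

lemma incr_nonneg:
  assumes "i \<in> N" "j \<in> {1..m}"
  shows "0 \<le> incr f i j"
proof -
  have "f i (j - 1) \<le> f i j"
    using cost_mono[OF assms(1)] assms(2) by (auto simp: mono_on_def)
  moreover have "0 \<le> f i (j - 1)" using cost_nonneg assms by auto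
  ultimately show ?thesis
    unfolding incr_def by (cases "f i j"; cases "f i (j - 1)") auto
qed

text \<open>A finite increment forces both neighbouring costs to be finite, under the convention
  \<open>\<infinity> - \<infinity> = \<infinity>\<close>, so the sum telescopes. Leaving
  \<open>c\<close> open admits dual left-hand sides of full buckets as well as the increments
  themselves.\<close>

lemma cost_eq_sum_incr:
  assumes "\<And>j. j \<in> {1..y} \<Longrightarrow> incr f i j = ereal (c j)"
  shows "f i y = f i 0 + ereal (\<Sum>j=1..y. c j)"
  using assms
proof (induction y)
  case 0
  then show ?case by simp
next
  case (Suc y)
  then have "f i y = f i 0 + ereal (\<Sum>j=1..y. c j)" by simp
  moreover have "f i (Suc y) - f i y = ereal (c (Suc y))"
    using Suc.prems[of "Suc y"] by (simp add: incr_def)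
  ultimately show ?case
    by (cases "f i (Suc y)"; cases "f i y"; cases "f i 0") auto
qed

lemma incr_finite:
  assumes "i \<in> N" "y \<le> m" "f i y < \<infinity>" "j \<in> {1..y}"
  obtains c where "incr f i j = ereal c"
proof -
  have "f i (j - 1) \<le> f i y" "f i j \<le> f i y"
    using assms(2,4) by (auto intro!: mono_onD[OF cost_mono[OF assms(1)]])
  moreover have "0 \<le> f i (j - 1)" "0 \<le> f i j" using cost_nonneg assms by auto
  ultimately show ?thesis
    using assms(3) that unfolding incr_def
    by (cases "f i j"; cases "f i (j - 1)"; cases "f i y") auto
qed

lemma dual_lhs_mono:
  assumes "\<And>aF. v aF \<le> v' aF"
  shows "dual_lhs N D m v i j \<le> dual_lhs N D m v' i j"
  unfolding dual_lhs_def by (intro sum_mono mult_left_mono assms) auto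

text \<open>The left-hand side only grows, while dual feasibility bounds it by the increment that it
  already equals.\<close>

lemma full_mono:
  assumes "\<And>aF. v aF \<le> v' aF" "dual_feasible N D m f v'" "i \<in> N" "j \<in> {1..m}"
    "full N D m f v i j"
  shows "full N D m f v' i j"
proof -
  have "ereal (dual_lhs N D m v i j) \<le> ereal (dual_lhs N D m v' i j)"
    using dual_lhs_mono[of v v', OF assms(1)] by simp
  moreover have "ereal (dual_lhs N D m v' i j) \<le> incr f i j"
    using assms(2-4) by (auto simp: dual_feasible_def)
  ultimately show ?thesis
    using assms(5) unfolding full_def by (metis antisym)
qed

lemma routing_mono:
  assumes "\<And>aF. v aF \<le> v' aF" "dual_feasible N D m f v'" "routing v a t"
  shows "routing v' a t"
  using assms(3) unfolding routing_def
  by (auto intro!: full_mono[OF assms(1,2)])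

lemma supported_mono:
  assumes "\<And>aF. v aF \<le> v' aF" "dual_feasible N D m f v'" "supported v a b u"
  shows "supported v' a b u"
  using assms(3) routing_mono[OF assms(1,2)] unfolding supported_def by blast

section \<open>Counting the water that a raised variable sends into buckets\<close>

lemma current_in_indices:
  assumes "routing v a t"
  shows "current m a (route_sets N m t) \<in> indices N m"
proof -
  have t: "1 \<le> t i l" "t i l \<le> l" if "i \<in> N" "1 \<le> l" "l \<le> m" for i l
    using assms that by (auto simp: routing_def)
  have un: "(\<Union>k<m. route_sets N m t i k \<inter> {Suc (a i)..m}) = {Suc (a i)..m}" if "i \<in> N" for i
  proof (intro equalityI subsetI)
    fix l assume l: "l \<in> {Suc (a i)..m}"
    then have "l \<in> route_sets N m t i (l - t i l)" "l - t i l < m"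
      using t[OF that, of l] that by (auto simp: mem_route_sets)
    then show "l \<in> (\<Union>k<m. route_sets N m t i k \<inter> {Suc (a i)..m})" using l by auto
  qed auto
  \<comment> \<open>Offsets \<open>l - t i l\<close> stay below \<open>m\<close> because
    \<open>1 \<le> t i l\<close>.\<close>
  have "route_sets N m t i k = {}" if "i \<notin> N \<or> m \<le> k" for i k
  proof -
    have "l - t i l \<noteq> k" if "i \<in> N" "1 \<le> l" "l \<le> m" for l
      using t[OF that] that \<open>i \<notin> N \<or> m \<le> k\<close> by auto
    then show ?thesis unfolding route_sets_def by force
  qed
  moreover have "Suc k \<le> l" if "l \<in> route_sets N m t i k" for i k l
  proof -
    have "i \<in> N" "1 \<le> l" "l \<le> m" "k = l - t i l" using that by (auto simp: mem_route_sets)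
    with t[of i l] show ?thesis by linarith
  qed
  moreover have "disjoint_family_on (\<lambda>k. route_sets N m t i k \<inter> {Suc (a i)..m}) {..<m}" for i
    by (auto simp: disjoint_family_on_def mem_route_sets)
  moreover have "\<forall>i\<in>N. a i \<le> m" "\<forall>i. i \<notin> N \<longrightarrow> a i = 0" using assms by (auto simp: routing_def)
  ultimately show ?thesis
    using un unfolding indices_def current_def by auto
qed

text \<open>Since \<open>u i l \<le> l\<close>, the offset \<open>l - u i l\<close> determines the
  bucket despite truncated subtraction.\<close>

lemma tau_current:
  assumes "routing v b u" "i \<in> N"
  shows "tau N D m i j (current m b (route_sets N m u)) =
    card {l \<in> {b i<..cap N D m b i}. u i l = j}"
proof -
  have "cap N D m b i \<le> m" by (simp add: cap_def)
  moreover have le: "u i l \<le> l" if "1 \<le> l" "l \<le> m" for l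
    using assms that by (auto simp: routing_def)
  moreover have "u i l = j" if "1 \<le> l" "l \<le> m" "j \<le> l" "l - j = l - u i l" for l
    using le[OF that(1,2)] that(3,4) by linarith
  ultimately have "{l. j \<le> l \<and> l \<in> route_sets N m u i (l - j) \<inter> {b i + 1..m} \<and> l \<le> cap N D m b i}
      = {l \<in> {b i<..cap N D m b i}. u i l = j}"
    using \<open>i \<in> N\<close> by (auto simp: mem_route_sets)
  then show ?thesis unfolding tau_def current_def by simp
qed

lemma sum_tau_current:
  assumes "routing v b u" "i \<in> N"
  shows "(\<Sum>j\<in>{b i<..y}. tau N D m i j (current m b (route_sets N m u))) =
    card {l \<in> {b i<..cap N D m b i}. u i l \<le> y}"
proof -
  let ?S = "{l \<in> {b i<..cap N D m b i}. u i l \<le> y}"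
  have "cap N D m b i \<le> m" by (simp add: cap_def)
  \<comment> \<open>No level above \<open>b i\<close> pours at or below \<open>b i\<close>, so
    grouping by the buckets in \<open>{b i<..y}\<close> loses nothing.\<close>
  then have img: "u i ` ?S \<subseteq> {b i<..y}"
    using assms unfolding routing_def by force
  have "(\<Sum>j\<in>{b i<..y}. tau N D m i j (current m b (route_sets N m u))) =
      (\<Sum>j\<in>{b i<..y}. \<Sum>l\<in>{l \<in> ?S. u i l = j}. 1)"
    unfolding tau_current[OF assms]
    by (intro sum.cong refl) (auto intro!: arg_cong[where f = card])
  also have "\<dots> = (\<Sum>l\<in>?S. 1)"
    by (rule sum.group[OF _ _ img]) auto
  finally show ?thesis by simp
qed

text \<open>Exchanging the sums gives each dual variable a multiplicity; the multiplicities for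
  \<open>y = a\<close> and for \<open>y = x\<close> are later compared variable by variable.\<close>

lemma sum_dual_lhs:
  "(\<Sum>i\<in>N. \<Sum>j=1..y i. dual_lhs N D m v i j) =
   (\<Sum>aF\<in>indices N m. real (\<Sum>i\<in>N. \<Sum>j\<in>{fst aF i<..y i}. tau N D m i j aF) * v aF)"
proof -
  note fin = finite_indices[OF finite_N, of m]
  have "dual_lhs N D m v i j =
      (\<Sum>aF\<in>indices N m. if fst aF i < j then real (tau N D m i j aF) * v aF else 0)" for i j
    unfolding dual_lhs_def by (simp add: sum.inter_filter[OF fin])
  then have "(\<Sum>i\<in>N. \<Sum>j=1..y i. dual_lhs N D m v i j) =
     (\<Sum>i\<in>N. \<Sum>aF\<in>indices N m. \<Sum>j=1..y i.
        if fst aF i < j then real (tau N D m i j aF) * v aF else 0)"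
    by (simp add: sum.swap[of _ "indices N m"])
  also have "\<dots> = (\<Sum>aF\<in>indices N m. \<Sum>i\<in>N. \<Sum>j=1..y i.
        if fst aF i < j then real (tau N D m i j aF) * v aF else 0)"
    by (rule sum.swap)
  also have "\<dots> = (\<Sum>aF\<in>indices N m. \<Sum>i\<in>N. \<Sum>j\<in>{fst aF i<..y i}. real (tau N D m i j aF) * v aF)"
    by (intro sum.cong refl sum.mono_neutral_cong_right) auto
  finally show ?thesis by (simp add: sum_distrib_right)
qed

text \<open>This is the primal covering constraint of a routed index, tested on the integral
  solution \<open>x\<close>. Water never flows upwards, so item \<open>i\<close> collects at least
  \<open>min (x i - b i) (residual N D b)\<close>.\<close>

lemma residual_le_sum_tau:
  assumes "routing v b u" "x \<in> feasible N D m"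
  shows "residual N D b \<le>
    (\<Sum>i\<in>N. \<Sum>j\<in>{b i<..x i}. tau N D m i j (current m b (route_sets N m u)))"
proof -
  let ?R = "residual N D b" and ?c = "cap N D m b"
  have x: "x i \<le> m" if "i \<in> N" for i using assms(2) that by (auto simp: feasible_def)
  have lower: "min (x i - b i) ?R \<le>
      (\<Sum>j\<in>{b i<..x i}. tau N D m i j (current m b (route_sets N m u)))" if "i \<in> N" for i
  proof -
    have "u i l \<le> x i" if "b i < l" "l \<le> x i" for l
    proof -
      have "u i l \<le> l" using assms(1) \<open>i \<in> N\<close> that x[OF \<open>i \<in> N\<close>] by (auto simp: routing_def)
      then show ?thesis using that by simp
    qed
    then have "{b i<..min (x i) (?c i)} \<subseteq> {l \<in> {b i<..?c i}. u i l \<le> x i}" by auto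
    then have "card {b i<..min (x i) (?c i)} \<le> card {l \<in> {b i<..?c i}. u i l \<le> x i}"
      by (intro card_mono) auto
    moreover have "min (x i - b i) ?R \<le> card {b i<..min (x i) (?c i)}"
      using x[OF that] by (auto simp: cap_def)
    ultimately show ?thesis using sum_tau_current[OF assms(1) that] by simp
  qed
  \<comment> \<open>Either one item alone attains the residual demand, or nothing is truncated and
    the total surplus of \<open>x\<close> over \<open>b\<close> attains it.\<close>
  have "?R \<le> (\<Sum>i\<in>N. min (x i - b i) ?R)"
  proof (cases "\<exists>i\<in>N. ?R \<le> x i - b i")
    case True
    then obtain i where "i \<in> N" "?R \<le> x i - b i" by auto
    then show ?thesis
      using member_le_sum[of i N "\<lambda>i. min (x i - b i) ?R"] finite_N by (simp add: min_absorb2)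
  next
    case False
    then have "(\<Sum>i\<in>N. min (x i - b i) ?R) = (\<Sum>i\<in>N. x i - b i)"
      by (intro sum.cong) auto
    moreover have "(\<Sum>i\<in>N. x i) \<le> (\<Sum>i\<in>N. b i + (x i - b i))" by (intro sum_mono) auto
    moreover have "D \<le> (\<Sum>i\<in>N. x i)" using assms(2) by (simp add: feasible_def)
    ultimately show ?thesis by (simp add: residual_def sum.distrib)
  qed
  also have "\<dots> \<le> (\<Sum>i\<in>N. \<Sum>j\<in>{b i<..x i}. tau N D m i j (current m b (route_sets N m u)))"
    by (intro sum_mono lower)
  finally show ?thesis .
qed

text \<open>By \<open>supported\<close>, every level beyond \<open>b\<close> that pours into a
  bought bucket is itself bought.\<close>

lemma sum_tau_le:
  assumes "supported v a b u"
  shows "(\<Sum>i\<in>N. \<Sum>j\<in>{b i<..a i}. tau N D m i j (current m b (route_sets N m u))) \<le>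
    (\<Sum>i\<in>N. min (a i) (cap N D m b i) - b i)"
proof (rule sum_mono)
  fix i assume i: "i \<in> N"
  have r: "routing v b u" using assms by (simp add: supported_def)
  have "cap N D m b i \<le> m" by (simp add: cap_def)
  then have "{l \<in> {b i<..cap N D m b i}. u i l \<le> a i} \<subseteq> {b i<..min (a i) (cap N D m b i)}"
    using assms i by (auto simp: supported_def)
  then have "card {l \<in> {b i<..cap N D m b i}. u i l \<le> a i} \<le> card {b i<..min (a i) (cap N D m b i)}"
    by (intro card_mono) auto
  then show "(\<Sum>j\<in>{b i<..a i}. tau N D m i j (current m b (route_sets N m u))) \<le>
      min (a i) (cap N D m b i) - b i"
    using sum_tau_current[OF r i] by simp
qed

text \<open>For each nonzero variable, the residual demand at \<open>b\<close> separates the two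
  multiplicities: the bought buckets collect it at most twice, and \<open>x\<close> collects it at
  least once.\<close>

lemma sum_dual_lhs_le:
  assumes "step_inv (v, z, a, F)" "x \<in> feasible N D m"
  shows "(\<Sum>i\<in>N. \<Sum>j=1..a i. dual_lhs N D m v i j) \<le>
    2 * (\<Sum>i\<in>N. \<Sum>j=1..x i. dual_lhs N D m v i j)"
  unfolding sum_dual_lhs sum_distrib_left
proof (rule sum_mono)
  fix aF assume aF: "aF \<in> indices N m"
  let ?W = "\<lambda>y. \<Sum>i\<in>N. \<Sum>j\<in>{fst aF i<..y i}. tau N D m i j aF"
  show "real (?W a) * v aF \<le> 2 * (real (?W x) * v aF)"
  proof (cases "v aF = 0")
    case False
    then obtain b u where bu: "aF = current m b (route_sets N m u)" "supported v a b u"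
        "(\<Sum>i\<in>N. min (a i) (cap N D m b i) - b i) \<le> 2 * residual N D b"
      using assms(1) aF unfolding step_inv_def by blast
    have fst: "fst aF = b" using bu(1) by (simp add: current_def)
    have "?W a \<le> 2 * residual N D b"
      unfolding fst unfolding bu(1) using sum_tau_le[OF bu(2)] bu(3) by linarith
    moreover have "residual N D b \<le> ?W x"
      unfolding fst unfolding bu(1)
      using bu(2) by (intro residual_le_sum_tau[of v, OF _ assms(2)]) (simp add: supported_def)
    ultimately have "?W a \<le> 2 * ?W x" by linarith
    then have "real (?W a) \<le> 2 * real (?W x)" by linarith
    moreover have "0 \<le> v aF" using assms(1) aF by (auto simp: step_inv_def dual_feasible_def)
    ultimately show ?thesis using mult_right_mono[of "real (?W a)" "2 * real (?W x)" "v aF"]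
      by (simp add: mult.assoc)
  qed simp
qed

section \<open>Preservation of the invariant by one iteration\<close>

lemma step_inv_init: "step_inv (init N m)"
proof -
  \<comment> \<open>Initially every level pours into its own bucket.\<close>
  have "(\<lambda>i k. if i \<in> N \<and> k = 0 then {1..m} else {}) = route_sets N m (\<lambda>i l. l)"
    by (auto simp: route_sets_def fun_eq_iff)
  moreover have "routing (\<lambda>_. 0) (\<lambda>_. 0) (\<lambda>i l. l)" by (auto simp: routing_def)
  moreover have "dual_feasible N D m f (\<lambda>_. 0)"
    using incr_nonneg by (simp add: dual_feasible_def dual_lhs_def flip: zero_ereal_def)
  ultimately show ?thesis unfolding step_inv_def init_def by (auto simp: fun_eq_iff)
qed

text \<open>Before the step the demand is uncovered, so the levels bought since \<open>b\<close> number less than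
  \<open>residual N D b\<close>; the step changes a single item, and the cap limits what that item adds.\<close>
lemma sum_min_cap_le:
  assumes "residual N D a > 0" "\<And>i. b i \<le> a i"
  shows "(\<Sum>x\<in>N. min ((a(i := q)) x) (cap N D m b x) - b x) \<le> 2 * residual N D b"
proof -
  let ?g = "\<lambda>x. min ((a(i := q)) x) (cap N D m b x) - b x"
  have "(\<Sum>x\<in>N. a x - b x) = (\<Sum>x\<in>N. a x) - (\<Sum>x\<in>N. b x)"
    by (rule sum_subtractf_nat) (use assms in auto)
  then have "(\<Sum>x\<in>N. a x - b x) \<le> residual N D b"
    using assms(1) by (simp add: residual_def)
  moreover have "sum ?g N \<le> (\<Sum>x\<in>N. (a x - b x) + (if x = i then residual N D b else 0))"
    by (intro sum_mono) (auto simp: cap_def)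
  moreover have "(\<Sum>x\<in>N. (if x = i then residual N D b else 0)) \<le> residual N D b"
    using finite_N by simp
  ultimately show ?thesis by (simp add: sum.distrib)
qed

lemma raise_until_tight_ge:
  assumes "raise_until_tight N D m f v a F v' i j"
  shows "v aF \<le> v' aF"
  using assms by (auto simp: raise_until_tight_def)

text \<open>Only the current variable can newly become nonzero, and it is supported by the current
  routing with \<open>b = a\<close>.\<close>

lemma step_inv_raise:
  assumes inv: "step_inv (v, z, a, F)" and res: "residual N D a > 0"
    and raise: "raise_until_tight N D m f v a F v' i j"
  shows "step_inv (v', z, a, F)"
proof -
  from inv obtain t where t: "F = route_sets N m t" "routing v a t"
    and full: "\<forall>i\<in>N. \<forall>j\<in>{1..a i}. full N D m f v i j"
    and z: "z = (\<lambda>i l. if l \<in> {1..a i} then 1 else 0)"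
    and supp: "\<And>aF. aF \<in> indices N m \<Longrightarrow> v aF \<noteq> 0 \<Longrightarrow>
        (\<exists>b u. aF = current m b (route_sets N m u) \<and> supported v a b u \<and>
          (\<Sum>i\<in>N. min (a i) (cap N D m b i) - b i) \<le> 2 * residual N D b)"
    unfolding step_inv_def by blast
  note ge = raise_until_tight_ge[OF raise]
  have df: "dual_feasible N D m f v'" using raise by (simp add: raise_until_tight_def)
  have r: "routing v' a t" by (rule routing_mono[OF ge df t(2)])
  have am: "a i \<le> m" if "i \<in> N" for i using t(2) that by (simp add: routing_def)
  have "\<exists>b u. aF = current m b (route_sets N m u) \<and> supported v' a b u \<and>
          (\<Sum>i\<in>N. min (a i) (cap N D m b i) - b i) \<le> 2 * residual N D b"
    if aF: "aF \<in> indices N m" "v' aF \<noteq> 0" for aF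
  proof (cases "aF = current m a F")
    case True
    moreover have "supported v' a a t"
      using r unfolding supported_def routing_def
      by (auto simp: not_le)
    \<comment> \<open>Taking \<open>q = a i\<close> makes the update in
      \<open>sum_min_cap_le\<close> vacuous.\<close>
    moreover have "(\<Sum>i\<in>N. min (a i) (cap N D m a i) - a i) \<le> 2 * residual N D a"
      using sum_min_cap_le[OF res, of a i "a i"] by simp
    ultimately show ?thesis using t(1) by blast
  next
    case False
    then have "v aF \<noteq> 0" using raise aF by (auto simp: raise_until_tight_def)
    with supp[OF aF(1)] supported_mono[OF ge df] show ?thesis by blast
  qed
  moreover have "full N D m f v' i j" if "i \<in> N" "j \<in> {1..a i}" for i j
    using full_mono[OF ge df that(1)] am[OF that(1)] full that by auto
  ultimately show ?thesis
    unfolding step_inv_def using t r df z by blast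
qed

text \<open>The last property is the decisive one: maximality of \<open>q\<close> leaves a non-full
  bucket \<open>q + 1\<close>, which is a barrier for the water.\<close>

lemma advance_level:
  assumes "a i < m" "full N D m f v i (a i + 1)"
    "q = Max {q. a i < q \<and> q \<le> m \<and> (\<forall>l\<in>{a i + 1..q}. full N D m f v i l)}"
  shows "a i < q" "q \<le> m" "\<forall>l\<in>{a i + 1..q}. full N D m f v i l"
    "q < m \<Longrightarrow> \<not> full N D m f v i (q + 1)"
proof -
  let ?Q = "{q. a i < q \<and> q \<le> m \<and> (\<forall>l\<in>{a i + 1..q}. full N D m f v i l)}"
  have fin: "finite ?Q" by (rule finite_subset[of _ "{..m}"]) auto
  have "a i + 1 \<in> ?Q" using assms by auto
  then have q: "q \<in> ?Q" using Max_in[OF fin] unfolding assms(3) by blast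
  then show "a i < q" "q \<le> m" "\<forall>l\<in>{a i + 1..q}. full N D m f v i l" by auto
  assume "q < m"
  show "\<not> full N D m f v i (q + 1)"
  proof
    assume "full N D m f v i (q + 1)"
    then have "q + 1 \<in> ?Q" using q \<open>q < m\<close> by (auto simp: le_Suc_eq)
    then have "q + 1 \<le> Max ?Q" by (rule Max_ge[OF fin])
    then show False using assms(3) by linarith
  qed
qed

lemma step_inv_advance:
  assumes inv: "step_inv (v, z, a, F)" and res: "residual N D a > 0"
    and i: "i \<in> N" and q: "a i < q" "q \<le> m" "\<forall>l\<in>{a i + 1..q}. full N D m f v i l"
      "q < m \<Longrightarrow> \<not> full N D m f v i (q + 1)"
  shows "step_inv (v, z(i := \<lambda>l. if l \<in> {a i + 1..q} then 1 else z i l), a(i := q), F)"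
proof -
  from inv obtain t where t: "F = route_sets N m t" "routing v a t"
    and df: "dual_feasible N D m f v"
    and full: "\<forall>i\<in>N. \<forall>j\<in>{1..a i}. full N D m f v i j"
    and z: "z = (\<lambda>i l. if l \<in> {1..a i} then 1 else 0)"
    and supp: "\<And>aF. aF \<in> indices N m \<Longrightarrow> v aF \<noteq> 0 \<Longrightarrow>
        (\<exists>b u. aF = current m b (route_sets N m u) \<and> supported v a b u \<and>
          (\<Sum>i\<in>N. min (a i) (cap N D m b i) - b i) \<le> 2 * residual N D b)"
    unfolding step_inv_def by blast
  \<comment> \<open>A route from above \<open>q\<close> to \<open>q\<close> or below would need
    bucket \<open>q + 1\<close> to be full. This applies to the current routing and to all earlier
    ones recorded in \<open>supported\<close>, since they too are routings for the present
    \<open>v\<close>.\<close>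
  have cross: "l \<le> q" if "routing v b u" "1 \<le> l" "l \<le> m" "u i l \<le> q" for b u l
  proof (rule ccontr)
    assume l: "\<not> l \<le> q"
    then have "q + 1 \<in> {u i l<..l}" using that by auto
    moreover have "\<forall>x\<in>{u i l<..l}. full N D m f v i x"
      using that(1-3) i unfolding routing_def by simp
    ultimately have "full N D m f v i (q + 1)" by blast
    then show False using q(4) l that by auto
  qed
  have "q < t i l" if "q < l" "l \<le> m" for l
    using cross[OF t(2), of l] that by linarith
  then have "routing v (a(i := q)) t"
    using t(2) q(2) i unfolding routing_def by auto
  moreover have "\<exists>b u. aF = current m b (route_sets N m u) \<and> supported v (a(i := q)) b u \<and>
          (\<Sum>x\<in>N. min ((a(i := q)) x) (cap N D m b x) - b x) \<le> 2 * residual N D b"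
    if "aF \<in> indices N m" "v aF \<noteq> 0" for aF
  proof -
    obtain b u where bu: "aF = current m b (route_sets N m u)" "supported v a b u"
      using supp[OF \<open>aF \<in> indices N m\<close> \<open>v aF \<noteq> 0\<close>] by blast
    have "b i \<le> q" using bu(2) q(1) unfolding supported_def by (meson le_trans less_imp_le)
    then have "supported v (a(i := q)) b u"
      using bu(2) cross[of b u] unfolding supported_def by auto
    moreover have "b i \<le> a i" for i using bu(2) by (simp add: supported_def)
    ultimately show ?thesis using bu(1) sum_min_cap_le[OF res] by blast
  qed
  moreover have "\<forall>x\<in>N. \<forall>j\<in>{1..(a(i := q)) x}. full N D m f v x j"
  proof (intro ballI)
    fix x j assume "x \<in> N" "j \<in> {1..(a(i := q)) x}"
    then show "full N D m f v x j"
      using full q(3) by (cases "x = i"; cases "j \<le> a i") auto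
  qed
  moreover have "z(i := \<lambda>l. if l \<in> {a i + 1..q} then 1 else z i l) =
      (\<lambda>x l. if l \<in> {1..(a(i := q)) x} then 1 else 0)"
    using z q(1) by (auto simp: fun_eq_iff)
  ultimately show ?thesis
    unfolding step_inv_def using t df by blast
qed

lemma redirect_bounds:
  assumes "{p \<in> {1..<j}. \<not> P p} \<noteq> {}" "p = Max {p \<in> {1..<j}. \<not> P p}"
    "q = Min ({q \<in> {j<..m}. \<not> P q} \<union> {m + 1})" "j \<le> m"
  shows "1 \<le> p" "p < j" "\<not> P p" "\<And>l. l \<in> {p<..<j} \<Longrightarrow> P l"
    "j < q" "q \<le> m + 1" "q \<le> m \<Longrightarrow> \<not> P q" "\<And>l. l \<in> {j<..<q} \<Longrightarrow> P l"
proof -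
  let ?A = "{p \<in> {1..<j}. \<not> P p}" and ?B = "{q \<in> {j<..m}. \<not> P q} \<union> {m + 1}"
  have "p \<in> ?A" using Max_in[of ?A] assms by auto
  then show p: "1 \<le> p" "p < j" "\<not> P p" by auto
  show "P l" if "l \<in> {p<..<j}" for l
  proof (rule ccontr)
    assume "\<not> P l"
    then have "l \<in> ?A" using that by auto
    then have "l \<le> Max ?A" by (intro Max_ge) auto
    then show False using that unfolding assms(2) by (meson greaterThanLessThan_iff leD)
  qed
  have "q \<in> ?B" using Min_in[of ?B] assms(3) by auto
  then show q: "j < q" "q \<le> m + 1" "q \<le> m \<Longrightarrow> \<not> P q" using assms(4) by auto
  show "P l" if "l \<in> {j<..<q}" for l
  proof (rule ccontr)
    assume "\<not> P l"
    then have "l \<in> ?B" using that q(2) by auto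
    then have "Min ?B \<le> l" by (intro Min_le) auto
    then show False using that unfolding assms(3) by (meson greaterThanLessThan_iff leD)
  qed
qed

text \<open>Since \<open>t i l \<le> l\<close>, a level \<open>l \<ge> j\<close> sits at offset
  \<open>l - j\<close> only if \<open>t i l = j\<close>; moving it to offset \<open>l - p\<close>
  makes \<open>p\<close> its bucket.\<close>

lemma shift_route_sets:
  assumes "routing v a t" "i \<in> N" "p < j" "q \<le> m + 1" "1 \<le> j"
  shows "shift (route_sets N m t) i j p q =
    route_sets N m (t(i := \<lambda>l. if l \<in> {j..<q} \<and> t i l = j then p else t i l))"
proof (intro ext set_eqI)
  fix x k l
  have "t i l \<le> l" if "1 \<le> l" "l \<le> m"
    using assms(1,2) that by (auto simp: routing_def)
  then show "l \<in> shift (route_sets N m t) i j p q x k \<longleftrightarrow>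
    l \<in> route_sets N m (t(i := \<lambda>l. if l \<in> {j..<q} \<and> t i l = j then p else t i l)) x k"
    using assms(2-5) by (auto simp: shift_def mem_route_sets)
qed

lemma step_inv_redirect:
  assumes inv: "step_inv (v, z, a, F)" and i: "i \<in> N" and j: "a i + 1 < j" "j \<le> m"
    and fullj: "full N D m f v i j"
    and p: "{p \<in> {1..<j}. \<not> full N D m f v i p} \<noteq> {}"
      "p = Max {p \<in> {1..<j}. \<not> full N D m f v i p}"
    and q: "q = Min ({q \<in> {j<..m}. \<not> full N D m f v i q} \<union> {m + 1})"
  shows "step_inv (v, z, a, shift F i j p q)"
proof -
  note pq = redirect_bounds[OF p q j(2)]
  from inv obtain t where t: "F = route_sets N m t" "routing v a t"
    and full: "\<forall>i\<in>N. \<forall>j\<in>{1..a i}. full N D m f v i j"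
    unfolding step_inv_def by blast
  let ?t = "t(i := \<lambda>l. if l \<in> {j..<q} \<and> t i l = j then p else t i l)"
  \<comment> \<open>Every bucket up to \<open>a i\<close> is full and \<open>p\<close> is not, so
    redirected levels still pour above \<open>a i\<close>.\<close>
  have ap: "a i < p" using full i pq(1,3) by (force simp: not_le[symmetric])
  \<comment> \<open>All buckets strictly between \<open>p\<close> and \<open>q\<close> are full:
    \<open>j\<close> by assumption, the others by the choice of \<open>p\<close> and
    \<open>q\<close>.\<close>
  have "full N D m f v i b" if "b \<in> {p<..l}" "l \<in> {j..<q}" for b l
    using that pq(4)[of b] pq(8)[of b] fullj by (cases b j rule: linorder_cases) auto
  then have "routing v a ?t"
    using t(2) ap pq(1,2) unfolding routing_def by auto
  moreover have "shift F i j p q = route_sets N m ?t"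
    unfolding t(1) by (rule shift_route_sets[OF t(2) i pq(2,6)]) (use j in auto)
  ultimately show ?thesis using inv unfolding step_inv_def by blast
qed

lemma step_step_inv:
  assumes "step N D m f s s'" "step_inv s"
  shows "step_inv s'"
  using assms(1)
proof cases
  case (advance a v F v' i j q z)
  have inv: "step_inv (v', z, a, F)"
    using step_inv_raise[OF _ advance(3,4)] assms(2) advance(1) by simp
  have r: "i \<in> N" "a i < m" "full N D m f v' i (a i + 1)"
    using advance(4,5) by (auto simp: raise_until_tight_def)
  note q = advance_level[of a i v' q, OF r(2,3) advance(6)]
  from step_inv_advance[OF inv advance(3) r(1) q] advance(2,5) show ?thesis by simp
next
  case (redirect a v F v' i j p q z)
  have inv: "step_inv (v', z, a, F)"
    using step_inv_raise[OF _ redirect(3,4)] assms(2) redirect(1) by simp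
  have r: "i \<in> N" "j \<le> m" "full N D m f v' i j"
    using redirect(4) by (auto simp: raise_until_tight_def)
  from step_inv_redirect[OF inv r(1) redirect(5) r(2,3) redirect(6-8)] redirect(2)
  show ?thesis by simp
qed

section \<open>Termination: the set of choosable buckets shrinks\<close>

lemma mem_remaining_route_sets:
  assumes "routing v a t"
  shows "(i, j) \<in> remaining N m (v', z, a, route_sets N m t) \<longleftrightarrow>
    i \<in> N \<and> a i < j \<and> (\<exists>l\<in>{1..m}. t i l = j)"
proof -
  have t: "1 \<le> t i l" "t i l \<le> l" if "i \<in> N" "1 \<le> l" "l \<le> m" for l
    using assms that by (auto simp: routing_def)
  show ?thesis
  proof
    assume "(i, j) \<in> remaining N m (v', z, a, route_sets N m t)"
    then obtain l where l: "i \<in> N" "a i < j" "j \<le> l" "1 \<le> l" "l \<le> m" "l - j = l - t i l"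
      by (auto simp: remaining_def mem_route_sets)
    then have "t i l = j" using t(2)[OF l(1,4,5)] by linarith
    then show "i \<in> N \<and> a i < j \<and> (\<exists>l\<in>{1..m}. t i l = j)" using l by auto
  next
    assume "i \<in> N \<and> a i < j \<and> (\<exists>l\<in>{1..m}. t i l = j)"
    then obtain l where l: "i \<in> N" "a i < j" "1 \<le> l" "l \<le> m" "t i l = j" by auto
    then show "(i, j) \<in> remaining N m (v', z, a, route_sets N m t)"
      using t[OF l(1,3,4)] by (auto simp: remaining_def mem_route_sets intro!: bexI[of _ l])
  qed
qed

lemma tau_pos_remaining:
  assumes "tau N D m i j (current m a F) > 0" "i \<in> N" "j \<in> {1..m}" "a i < j"
  shows "(i, j) \<in> remaining N m (v, z, a, F)"
proof -
  have "{l. j \<le> l \<and> l \<in> F i (l - j) \<inter> {a i + 1..m} \<and> l \<le> cap N D m a i} \<noteq> {}"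
    using assms(1) unfolding tau_def current_def case_prod_conv by (metis card.empty less_irrefl)
  then show ?thesis using assms unfolding remaining_def by auto
qed

text \<open>An advance keeps \<open>F\<close> and raises \<open>a i\<close> past the chosen bucket.
  A redirection takes all water from \<open>j\<close>, and the only bucket that can gain any,
  \<open>p\<close>, received some before.\<close>

lemma remaining_step:
  assumes "step N D m f s s'" "step_inv s"
  shows "remaining N m s' \<subset> remaining N m s"
  using assms(1)
proof cases
  case (advance a v F v' i j q z)
  have r: "i \<in> N" "a i < m" "full N D m f v' i (a i + 1)"
    using advance(4,5) by (auto simp: raise_until_tight_def)
  note q = advance_level[of a i v' q, OF r(2,3) advance(6)]
  have "(i, j) \<in> remaining N m s"
    using advance(1,4) by (auto simp: raise_until_tight_def intro!: tau_pos_remaining)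
  moreover have "(i, j) \<notin> remaining N m s'"
    using advance(2,5) q(1) by (auto simp: remaining_def)
  moreover have "remaining N m s' \<subseteq> remaining N m s"
    using advance(1,2) q(1) by (auto simp: remaining_def split: if_splits)
  ultimately show ?thesis by blast
next
  case (redirect a v F v' i j p q z)
  have inv: "step_inv (v', z, a, F)"
    using step_inv_raise[OF _ redirect(3,4)] assms(2) redirect(1) by simp
  have r: "i \<in> N" "j \<le> m" "1 \<le> j" "full N D m f v' i j"
    using redirect(4) by (auto simp: raise_until_tight_def)
  note pq = redirect_bounds[OF redirect(6-8) r(2)]
  from inv obtain t where t: "F = route_sets N m t" "routing v' a t"
    unfolding step_inv_def by blast
  let ?t = "t(i := \<lambda>l. if l \<in> {j..<q} \<and> t i l = j then p else t i l)"
  have shift: "shift F i j p q = route_sets N m ?t"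
    unfolding t(1) by (rule shift_route_sets[OF t(2) r(1) pq(2,6) r(3)])
  have ti: "1 \<le> t i l" "t i l \<le> l" "\<And>b. b \<in> {t i l<..l} \<Longrightarrow> full N D m f v' i b"
    if "1 \<le> l" "l \<le> m" for l
  proof -
    have "1 \<le> t i l \<and> t i l \<le> l \<and> (\<forall>b\<in>{t i l<..l}. full N D m f v' i b)"
      using t(2) r(1) that unfolding routing_def by simp
    then show "1 \<le> t i l" "t i l \<le> l" "\<And>b. b \<in> {t i l<..l} \<Longrightarrow> full N D m f v' i b"
      by blast+
  qed
  \<comment> \<open>As \<open>p\<close> is not full, its own level cannot pour further down.\<close>
  have tp: "t i p = p"
  proof (rule ccontr)
    assume "t i p \<noteq> p"
    then have "p \<in> {t i p<..p}" using ti(2)[of p] pq(1,2) r(2) by auto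
    then show False using ti(3)[of p p] pq(1-3) r(2) by auto
  qed
  have in_s: "(x, y) \<in> remaining N m s \<longleftrightarrow> x \<in> N \<and> a x < y \<and> (\<exists>l\<in>{1..m}. t x l = y)" for x y
    using mem_remaining_route_sets[OF t(2)] redirect(1) t(1) by simp
  have in_s': "x \<in> N \<and> a x < y \<and> (\<exists>l\<in>{1..m}. ?t x l = y)" if "(x, y) \<in> remaining N m s'" for x y
  proof -
    have m: "x \<in> N" "a x < y" "\<exists>l\<in>{y..m}. l \<in> route_sets N m ?t x (l - y)"
      using that redirect(2) shift by (auto simp: remaining_def)
    then obtain l where l: "y \<le> l" "l \<le> m" "1 \<le> l" "l - y = l - ?t x l"
      by (auto simp: mem_route_sets)
    moreover have "t x l \<le> l" using t(2) l m(1) by (auto simp: routing_def)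
    then have "?t x l \<le> l" using pq(2) by auto
    ultimately have "?t x l = y" by linarith
    then show ?thesis using m l by auto
  qed
  have "(i, j) \<in> remaining N m s"
    using redirect(1,4) by (auto simp: raise_until_tight_def intro!: tau_pos_remaining)
  moreover have "(i, j) \<notin> remaining N m s'"
  proof
    assume "(i, j) \<in> remaining N m s'"
    from in_s'[OF this] obtain l where l: "1 \<le> l" "l \<le> m" "?t i l = j" by auto
    then have tl: "t i l = j" "l \<notin> {j..<q}" using pq(2) by (auto split: if_splits)
    \<comment> \<open>Such an \<open>l\<close> lies at or beyond \<open>q\<close>, so its route down
      to \<open>j\<close> would pass the non-full bucket \<open>q\<close>; the default
      \<open>q = m + 1\<close> is excluded by \<open>q \<le> l \<le> m\<close>.\<close>
    then have "q \<in> {t i l<..l}" using ti[OF l(1,2)] pq(5) by auto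
    with ti(3)[OF l(1,2)] pq(7) l(2) show False by auto
  qed
  moreover have "remaining N m s' \<subseteq> remaining N m s"
  proof
    fix w assume w: "w \<in> remaining N m s'"
    obtain x y where xy: "w = (x, y)" by fastforce
    from in_s'[of x y] w xy obtain l where l: "x \<in> N" "a x < y" "1 \<le> l" "l \<le> m" "?t x l = y"
      by auto
    have "\<exists>l\<in>{1..m}. t x l = y"
    proof (cases "t x l = y")
      case False
      then have "x = i" "y = p" using l(5) by (auto split: if_splits)
      then show ?thesis using tp pq(1,2) r(2) by (intro bexI[of _ p]) auto
    qed (use l in auto)
    then show "w \<in> remaining N m s" using in_s xy l by auto
  qed
  ultimately show ?thesis by blast
qed

lemma remaining_subset: "remaining N m s \<subseteq> N \<times> {1..m}"
  by (auto simp: remaining_def)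

text \<open>The number of remaining buckets is a potential that starts at no more than
  \<open>card N * m\<close> and drops in every step. The invariant joins the induction because
  \<open>remaining_step\<close> relies on it.\<close>

lemma steps_bound:
  assumes "(step N D m f ^^ k) (init N m) s"
  shows "step_inv s \<and> card (remaining N m s) + k \<le> card N * m"
  using assms
proof (induction k arbitrary: s)
  case 0
  have "card (remaining N m (init N m)) \<le> card (N \<times> {1..m})"
    by (rule card_mono[OF _ remaining_subset]) (use finite_N in auto)
  then show ?case using 0 step_inv_init by (simp add: card_cartesian_product)
next
  case (Suc k)
  then obtain s0 where s0: "(step N D m f ^^ k) (init N m) s0" "step N D m f s0 s" by auto
  have IH: "step_inv s0" "card (remaining N m s0) + k \<le> card N * m" using Suc.IH[OF s0(1)] by auto
  have "finite (remaining N m s0)"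
    by (rule finite_subset[OF remaining_subset]) (use finite_N in auto)
  then have "card (remaining N m s) < card (remaining N m s0)"
    using remaining_step[OF s0(2) IH(1)] by (rule psubset_card_mono)
  then show ?case using IH(2) step_step_inv[OF s0(2) IH(1)] by simp
qed

lemma reachable_step_inv: "reachable N D m f s \<Longrightarrow> step_inv s"
  unfolding reachable_def using steps_bound by (metis rtranclp_imp_relpowp)

section \<open>Existence of a next step\<close>

lemma dual_lhs_raise:
  assumes "aF \<in> indices N m"
  shows "dual_lhs N D m (v(aF := v aF + e)) i j =
    dual_lhs N D m v i j + (if fst aF i < j then real (tau N D m i j aF) * e else 0)"
proof -
  let ?S = "{x \<in> indices N m. fst x i < j}"
  have fin: "finite ?S" using finite_indices[OF finite_N] by simp
  have "dual_lhs N D m (v(aF := v aF + e)) i j =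
      (\<Sum>x\<in>?S. real (tau N D m i j x) * v x + (if x = aF then real (tau N D m i j aF) * e else 0))"
    unfolding dual_lhs_def by (intro sum.cong) (auto simp: algebra_simps)
  also have "\<dots> = dual_lhs N D m v i j + (if aF \<in> ?S then real (tau N D m i j aF) * e else 0)"
    using fin by (simp add: sum.distrib dual_lhs_def)
  finally show ?thesis using assms by simp
qed

text \<open>A ratio test: the largest feasible raise is the least quotient of slack and coefficient
  over the constraints with positive coefficient and finite increment. The given pair shows that
  there is such a constraint.\<close>

lemma ex_raise_until_tight:
  assumes inv: "step_inv (v, z, a, F)"
    and i: "i \<in> N" "j \<in> {1..m}" "a i < j" "tau N D m i j (current m a F) > 0" "incr f i j < \<infinity>"
  shows "\<exists>v' i' j'. raise_until_tight N D m f v a F v' i' j'"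
proof -
  let ?c = "current m a F"
  from inv obtain t where t: "F = route_sets N m t" "routing v a t"
    and df: "dual_feasible N D m f v"
    unfolding step_inv_def by blast
  have cI: "?c \<in> indices N m" using current_in_indices[OF t(2)] t(1) by simp
  have fst: "fst ?c = a" by (simp add: current_def)
  define S where "S = {(i, j). i \<in> N \<and> j \<in> {1..m} \<and> a i < j \<and> tau N D m i j ?c > 0 \<and> incr f i j < \<infinity>}"
  define slack where "slack = (\<lambda>(i, j).
    (real_of_ereal (incr f i j) - dual_lhs N D m v i j) / real (tau N D m i j ?c))"
  have "finite S" by (rule finite_subset[of _ "N \<times> {1..m}"]) (use finite_N in \<open>auto simp: S_def\<close>)
  moreover have "(i, j) \<in> S" using i by (simp add: S_def)
  ultimately have "\<exists>x\<in>S. \<forall>y\<in>S. slack x \<le> slack y"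
    by (metis arg_min_if_finite(1) arg_min_least empty_iff)
  then obtain i' j' where ij: "(i', j') \<in> S" "\<And>y. y \<in> S \<Longrightarrow> slack (i', j') \<le> slack y"
    by auto
  define e where "e = slack (i', j')"
  define v' where "v' = v(?c := v ?c + e)"
  have inc: "ereal (real_of_ereal (incr f x y)) = incr f x y" if "(x, y) \<in> S" for x y
    using that incr_nonneg[of x y] by (cases "incr f x y") (auto simp: S_def)
  have le: "dual_lhs N D m v x y \<le> real_of_ereal (incr f x y)" if "(x, y) \<in> S" for x y
  proof -
    have "ereal (dual_lhs N D m v x y) \<le> incr f x y"
      using df that by (auto simp: dual_feasible_def S_def)
    then show ?thesis using inc[OF that] by (metis ereal_less_eq(3))
  qed
  have e0: "0 \<le> e" using le[OF ij(1)] by (simp add: e_def slack_def)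
  have lhs: "dual_lhs N D m v' x y =
      dual_lhs N D m v x y + (if a x < y then real (tau N D m x y ?c) * e else 0)" for x y
    unfolding v'_def using dual_lhs_raise[OF cI] fst by simp
  have lhs_le: "ereal (dual_lhs N D m v' x y) \<le> incr f x y" if xy: "x \<in> N" "y \<in> {1..m}" for x y
  proof (cases "(x, y) \<in> S")
    case True
    then have tau: "0 < real (tau N D m x y ?c)" by (simp add: S_def)
    have "e \<le> slack (x, y)" using ij(2)[OF True] by (simp add: e_def)
    then have "real (tau N D m x y ?c) * e \<le> real_of_ereal (incr f x y) - dual_lhs N D m v x y"
      using tau by (simp add: slack_def field_simps)
    then have "dual_lhs N D m v' x y \<le> real_of_ereal (incr f x y)" using True by (simp add: lhs S_def)
    then show ?thesis using inc[OF True] by (metis ereal_less_eq(3))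
  next
    case False
    \<comment> \<open>Outside \<open>S\<close> the constraint has an infinite right-hand side, or
      the raise leaves its left-hand side unchanged.\<close>
    then consider "incr f x y = \<infinity>" | "dual_lhs N D m v' x y = dual_lhs N D m v x y"
      using xy by (cases "incr f x y") (auto simp: S_def lhs)
    then show ?thesis using df xy by cases (auto simp: dual_feasible_def)
  qed
  have "dual_feasible N D m f v'"
    using lhs_le df e0 unfolding dual_feasible_def by (auto simp: v'_def)
  moreover have "full N D m f v' i' j'"
  proof -
    have "dual_lhs N D m v' i' j' = real_of_ereal (incr f i' j')"
      using ij(1) by (simp add: lhs e_def slack_def S_def)
    then show ?thesis unfolding full_def using inc[OF ij(1)] by simp
  qed
  ultimately have "raise_until_tight N D m f v a F v' i' j'"
    using ij(1) e0 unfolding raise_until_tight_def v'_def S_def by auto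
  then show ?thesis by blast
qed

text \<open>Level \<open>a i + 1\<close> must pour above \<open>a i\<close> and not above itself,
  hence into its own bucket; the positive residual demand puts it within the cap.\<close>

lemma tau_next_pos:
  assumes "routing v a t" "i \<in> N" "a i < m" "residual N D a > 0"
  shows "tau N D m i (a i + 1) (current m a (route_sets N m t)) > 0"
proof -
  have "a i < t i (a i + 1) \<and> t i (a i + 1) \<le> a i + 1"
    using assms(1-3) by (force simp: routing_def)
  then have "t i (a i + 1) = a i + 1" by linarith
  then have "a i + 1 \<in> {l \<in> {a i<..cap N D m a i}. t i l = a i + 1}"
    using assms by (auto simp: cap_def)
  then show ?thesis
    unfolding tau_current[OF assms(1,2)] by (auto simp: card_gt_0_iff)
qed

lemma ex_step:
  assumes inv: "step_inv (v, z, a, F)" and res: "residual N D a > 0"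
    and x: "x \<in> feasible N D m" "\<And>i. i \<in> N \<Longrightarrow> f i (x i) < \<infinity>"
  shows "\<exists>t. step N D m f (v, z, a, F) t"
proof -
  from inv obtain t where t: "F = route_sets N m t" "routing v a t"
    unfolding step_inv_def by blast
  have "\<exists>i\<in>N. a i < x i"
  proof (rule ccontr)
    assume "\<not> ?thesis"
    then have "(\<Sum>i\<in>N. x i) \<le> (\<Sum>i\<in>N. a i)" by (intro sum_mono) (auto simp: not_less)
    then show False using res x(1) by (simp add: residual_def feasible_def)
  qed
  then obtain i where i: "i \<in> N" "a i < x i" by blast
  have xm: "x i \<le> m" using x(1) i by (simp add: feasible_def)
  obtain c where c: "incr f i (a i + 1) = ereal c"
    using incr_finite[OF i(1) xm x(2)[OF i(1)], of "a i + 1"] i(2) by auto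
  have pos: "tau N D m i (a i + 1) (current m a F) > 0"
    unfolding t(1) by (rule tau_next_pos[OF t(2) i(1) _ res]) (use i xm in simp)
  have "\<exists>v' i' j'. raise_until_tight N D m f v a F v' i' j'"
    by (rule ex_raise_until_tight[OF inv i(1) _ _ pos]) (use i xm c in auto)
  then obtain v' i j where r: "raise_until_tight N D m f v a F v' i j" by blast
  then have ij: "i \<in> N" "a i < j" "j \<le> m" by (auto simp: raise_until_tight_def)
  show ?thesis
  \<comment> \<open>If bucket \<open>a i + 1\<close> is full, it can be chosen with the same
    \<open>v'\<close>, since it receives water, and this gives an advance. Otherwise it supplies the
    non-full bucket below \<open>j\<close> that a redirection requires.\<close>
  proof (cases "full N D m f v' i (a i + 1)")
    case True
    have "tau N D m i (a i + 1) (current m a F) > 0"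
      unfolding t(1) by (rule tau_next_pos[OF t(2) ij(1) _ res]) (use ij in simp)
    then have "raise_until_tight N D m f v a F v' i (a i + 1)"
      using r True ij unfolding raise_until_tight_def by auto
    from step.advance[OF res this refl refl] show ?thesis by blast
  next
    case False
    then have "j \<noteq> a i + 1" using r by (auto simp: raise_until_tight_def)
    then have "j > a i + 1" using ij by simp
    moreover have "{p \<in> {1..<j}. \<not> full N D m f v' i p} \<noteq> {}"
      using False \<open>j > a i + 1\<close> by force
    ultimately show ?thesis using step.redirect[OF res r _ _ refl refl] by blast
  qed
qed

section \<open>Comparing costs with feasible solutions and with the optimum\<close>

lemma finite_cost_terms:
  assumes "x \<in> feasible N D m" "cost N f x < \<infinity>" "i \<in> N"
  shows "f i (x i) < \<infinity>"
proof -
  have "(\<Sum>j\<in>{i}. f j (x j)) \<le> cost N f x"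
    unfolding cost_def using finite_N assms(1,3) cost_nonneg
    by (intro sum_mono2) (auto simp: feasible_def)
  then show ?thesis using assms(2) by auto
qed

lemma decode_step_inv:
  assumes "step_inv (v, z, a, F)" "i \<in> N"
  shows "decode m z i = a i"
proof -
  have "a i \<le> m" "z = (\<lambda>i l. if l \<in> {1..a i} then 1 else 0)"
    using assms unfolding step_inv_def routing_def by auto
  then have "{0} \<union> {j \<in> {1..m}. z i j = 1} = {0..a i}" by auto
  moreover have "Max {0..a i} = a i" by (rule Max_eqI) auto
  ultimately show ?thesis by (simp only: decode_def)
qed

text \<open>Above the base costs \<open>f i 0\<close>, the cost of \<open>a\<close> equals its sum
  of dual left-hand sides because the bought buckets are full, while dual feasibility makes the
  corresponding sum for \<open>x\<close> a lower bound on the cost of \<open>x\<close>.\<close>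

lemma cost_le_double:
  assumes inv: "step_inv (v, z, a, F)" and x: "x \<in> feasible N D m"
  shows "cost N f a \<le> 2 * cost N f x"
proof (cases "cost N f x < \<infinity>")
  case True
  let ?L = "dual_lhs N D m v"
  let ?A = "\<Sum>i\<in>N. \<Sum>j=1..a i. ?L i j" and ?X = "\<Sum>i\<in>N. \<Sum>j=1..x i. ?L i j"
  define r where "r i = real_of_ereal (f i 0)" for i
  have xm: "x i \<le> m" if "i \<in> N" for i using x that by (simp add: feasible_def)
  have r: "f i 0 = ereal (r i)" "0 \<le> r i" if "i \<in> N" for i
  proof -
    have "f i 0 \<le> f i (x i)" using cost_mono[OF that] xm[OF that] by (auto simp: mono_on_def)
    then have "f i 0 < \<infinity>" using finite_cost_terms[OF x True that] by auto
    then show "f i 0 = ereal (r i)" "0 \<le> r i"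
      using cost_nonneg[OF that, of 0] by (cases "f i 0"; simp add: r_def)+
  qed
  have "f i (a i) = ereal (r i + (\<Sum>j=1..a i. ?L i j))" if "i \<in> N" for i
  proof -
    have "incr f i j = ereal (?L i j)" if "j \<in> {1..a i}" for j
      using inv \<open>i \<in> N\<close> that unfolding step_inv_def full_def by auto
    from cost_eq_sum_incr[OF this] show ?thesis using r[OF that] by simp
  qed
  then have A: "cost N f a = ereal ((\<Sum>i\<in>N. r i) + ?A)"
    unfolding cost_def by (simp add: sum.distrib)
  have "ereal (r i + (\<Sum>j=1..x i. ?L i j)) \<le> f i (x i)" if i: "i \<in> N" for i
  proof -
    define c where "c j = real_of_ereal (incr f i j)" for j
    have c: "incr f i j = ereal (c j)" if "j \<in> {1..x i}" for j
      by (rule incr_finite[OF i xm[OF i] finite_cost_terms[OF x True i] that]) (simp add: c_def)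
    have "?L i j \<le> c j" if "j \<in> {1..x i}" for j
    proof -
      have "ereal (?L i j) \<le> incr f i j"
        using inv i xm[OF i] that unfolding step_inv_def dual_feasible_def by auto
      then show ?thesis using c[OF that] by simp
    qed
    then have "(\<Sum>j=1..x i. ?L i j) \<le> (\<Sum>j=1..x i. c j)" by (rule sum_mono)
    then show ?thesis using cost_eq_sum_incr[OF c] r[OF i] by simp
  qed
  then have "(\<Sum>i\<in>N. ereal (r i + (\<Sum>j=1..x i. ?L i j))) \<le> cost N f x"
    unfolding cost_def by (rule sum_mono)
  then have X: "ereal ((\<Sum>i\<in>N. r i) + ?X) \<le> cost N f x" by (simp add: sum.distrib)
  have "?A \<le> 2 * ?X" by (rule sum_dual_lhs_le[OF inv x])
  \<comment> \<open>The base costs enter once on the left and twice on the right, so their sign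
    matters.\<close>
  moreover have "0 \<le> (\<Sum>i\<in>N. r i)" using r by (intro sum_nonneg) auto
  ultimately have "(\<Sum>i\<in>N. r i) + ?A \<le> 2 * ((\<Sum>i\<in>N. r i) + ?X)" by argo
  then have "cost N f a \<le> 2 * ereal ((\<Sum>i\<in>N. r i) + ?X)"
    unfolding A times_ereal.simps(1) numeral_eq_ereal ereal_less_eq(3) .
  also have "\<dots> \<le> 2 * cost N f x" by (rule ereal_mult_left_mono[OF X]) simp
  finally show ?thesis .
qed (auto simp: ereal_mult_infty)

lemma cost_le_opt:
  assumes "step_inv (v, z, a, F)"
  shows "cost N f a \<le> 2 * opt N D m f"
proof -
  \<comment> \<open>Halving first avoids pulling the factor out of the infimum.\<close>
  have "cost N f a / 2 \<le> cost N f x" if "x \<in> feasible N D m" for x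
    using cost_le_double[OF assms that]
    by (simp add: ereal_divide_le_pos)
  then have "cost N f a / 2 \<le> opt N D m f" unfolding opt_def by (rule INF_greatest)
  then show ?thesis by (simp add: ereal_divide_le_pos)
qed

end

text \<open>A guarantee for outputs alone could hold vacuously, so the iteration bound and the
  absence of deadlock are included. Deadlock is excluded only for a finite optimum: if every
  increment is infinite, no constraint ever becomes tight.\<close>

theorem theorem1:
  fixes N :: "'i set" and D m :: nat and f :: "'i \<Rightarrow> nat \<Rightarrow> ereal"
  assumes "finite N"
    and "m \<le> D"
    and "\<And>i j. i \<in> N \<Longrightarrow> j \<le> m \<Longrightarrow> f i j = \<infinity> \<or> (\<exists>r\<in>\<rat>. 0 \<le> r \<and> f i j = ereal r)"
    and "\<And>i. i \<in> N \<Longrightarrow> mono_on {0..m} (f i)"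
    and "feasible N D m \<noteq> {}"
  shows
    "(\<forall>v z. is_output N D m f v z \<longrightarrow>
        (\<forall>i\<in>N. \<forall>j\<in>{2..m}. z i j = 1 \<longrightarrow> z i (j - 1) = 1) \<and>
        (\<Sum>i\<in>N. decode m z i) \<ge> D \<and>
        cost N f (decode m z) \<le> 2 * opt N D m f) \<and>
     (\<forall>k s. (step N D m f ^^ k) (init N m) s \<longrightarrow> k \<le> card N * m) \<and>
     (opt N D m f < \<infinity> \<longrightarrow>
        (\<forall>v z a F. reachable N D m f (v, z, a, F) \<and> residual N D a > 0 \<longrightarrow>
           (\<exists>t. step N D m f (v, z, a, F) t)))"
proof -
  interpret knapsack_cover N D m f
    by unfold_locales (use assms(1,3,4) in force)+
  have approx: "(\<forall>i\<in>N. \<forall>j\<in>{2..m}. z i j = 1 \<longrightarrow> z i (j - 1) = 1) \<and>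
      (\<Sum>i\<in>N. decode m z i) \<ge> D \<and> cost N f (decode m z) \<le> 2 * opt N D m f"
    if "is_output N D m f v z" for v z
  proof -
    from that obtain a F where "reachable N D m f (v, z, a, F)" and res: "residual N D a = 0"
      by (auto simp: is_output_def)
    then have inv: "step_inv (v, z, a, F)" by (intro reachable_step_inv)
    then have z: "z = (\<lambda>i l. if l \<in> {1..a i} then 1 else 0)" by (auto simp: step_inv_def)
    have "\<forall>i\<in>N. \<forall>j\<in>{2..m}. z i j = 1 \<longrightarrow> z i (j - 1) = 1"
      unfolding z by auto
    moreover have "(\<Sum>i\<in>N. decode m z i) = (\<Sum>i\<in>N. a i)"
      using decode_step_inv[OF inv] by (intro sum.cong) auto
    moreover have "cost N f (decode m z) = cost N f a"
      unfolding cost_def using decode_step_inv[OF inv] by (intro sum.cong) auto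
    ultimately show ?thesis
      using res cost_le_opt[OF inv] by (simp add: residual_def)
  qed
  have progress: "\<exists>t. step N D m f (v, z, a, F) t"
    if fin: "opt N D m f < \<infinity>" and reach: "reachable N D m f (v, z, a, F)" and res: "residual N D a > 0" for v z a F
  proof -
    obtain x where x: "x \<in> feasible N D m" "cost N f x < \<infinity>"
      using fin unfolding opt_def INF_less_iff by blast
    show ?thesis
      by (rule ex_step[OF reachable_step_inv[OF reach] res x(1) finite_cost_terms[OF x]])
  qed
  have "k \<le> card N * m" if "(step N D m f ^^ k) (init N m) s" for k s
    using steps_bound[OF that] by simp
  then show ?thesis using approx progress by blast
qed

end
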